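(* Let $D$ be a digraph such that $\chi(D)\le 6$. Then $D$ is majority $3$-colorable.
   Context: Digraphs are finite, loopless, have no parallel edges, but may have anti-parallel pairs of edges (digons). $N^+(v)$ denotes the set of out-neighbors of $v$. The underlying graph $U(D)$ is the simple undirected graph on $V(D)$ in which $x\neq y$ are adjacent iff $(x,y)\in E(D)$ or $(y,x)\in E(D)$; $\chi(D)$ is the chromatic number of $U(D)$. A majority coloring of $D$ with $k$ colors is a map $c:V(D)\to\{1,\dots,k\}$ such that for every $v\in V(D)$, at most half of the out-neighbors $w\in N^+(v)$ satisfy $c(w)=c(v)$. $D$ is majority $k$-colorable if it has a majority coloring with $k$ colors. *)

theory Defs
  imports "Graph_Theory.Digraph_Component"
begin

definition out_neighbors :: "('a, 'b) pre_digraph \<Rightarrow> 'a \<Rightarrow> 'a set" where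
  "out_neighbors D v = {w. v \<rightarrow>\<^bsub>D\<^esub> w}"

text \<open>Undirected graphs are represented by symmetric digraphs, as in the library.\<close>

definition underlying_graph :: "('a, 'b) pre_digraph \<Rightarrow> ('a, 'a \<times> 'a) pre_digraph" where
  "underlying_graph D = with_proj (mk_symmetric D)"

definition proper_coloring :: "('a, 'b) pre_digraph \<Rightarrow> nat \<Rightarrow> ('a \<Rightarrow> nat) \<Rightarrow> bool" where
  "proper_coloring G k c \<longleftrightarrow>
     c ` verts G \<subseteq> {1..k} \<and> (\<forall>u v. u \<rightarrow>\<^bsub>G\<^esub> v \<longrightarrow> c u \<noteq> c v)"

text \<open>The minimum exists for finite loopless graphs (see \<open>ex_proper_coloring\<close> below); otherwise
  the value may be unspecified.\<close>

definition chromatic_number :: "('a, 'b) pre_digraph \<Rightarrow> nat" where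
  "chromatic_number G = (LEAST k. \<exists>c. proper_coloring G k c)"

definition majority_coloring :: "('a, 'b) pre_digraph \<Rightarrow> nat \<Rightarrow> ('a \<Rightarrow> nat) \<Rightarrow> bool" where
  "majority_coloring D k c \<longleftrightarrow>
     c ` verts D \<subseteq> {1..k} \<and>
     (\<forall>v \<in> verts D.
        2 * card {w \<in> out_neighbors D v. c w = c v} \<le> card (out_neighbors D v))"

definition majority_colorable :: "('a, 'b) pre_digraph \<Rightarrow> nat \<Rightarrow> bool" where
  "majority_colorable D k \<longleftrightarrow> (\<exists>c. majority_coloring D k c)"

lemma verts_underlying_graph [simp]: "verts (underlying_graph D) = verts D"
  by (simp add: underlying_graph_def mk_symmetric_def)

lemma underlying_graph_adj_iff:
  "u \<rightarrow>\<^bsub>underlying_graph D\<^esub> v \<longleftrightarrow> u \<rightarrow>\<^bsub>D\<^esub> v \<or> v \<rightarrow>\<^bsub>D\<^esub> u"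
  by (auto simp: underlying_graph_def mk_symmetric_def arcs_ends_conv)

lemma (in digraph) ex_proper_coloring:
  "\<exists>k c. proper_coloring (underlying_graph G) k c"
proof -
  obtain f where f: "bij_betw f (verts G) {1..card (verts G)}"
    by (metis finite_same_card_bij finite_verts finite_atLeastAtMost card_atLeastAtMost diff_Suc_1)
  have "f u \<noteq> f v" if "u \<rightarrow>\<^bsub>G\<^esub> v" for u v
  proof
    assume "f u = f v"
    with f adj_in_verts[OF that] have "u = v"
      by (auto simp: bij_betw_def inj_on_def)
    with that show False
      using adj_not_same by blast
  qed
  with f have "proper_coloring (underlying_graph G) (card (verts G)) f"
    unfolding proper_coloring_def underlying_graph_adj_iff
    by (metis bij_betw_imp_surj_on order_refl verts_underlying_graph)
  then show ?thesis
    by blast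
qed

end

theory Submission
  imports Defs
begin

text \<open>
  Pair up the six colour classes of a proper colouring of the underlying graph to get three parts
  \<open>0, 1, 2\<close>, each of which induces a bipartite digraph. A vertex of part \<open>i\<close> is only ever given
  colour \<open>i\<close> or colour \<open>i + 1\<close> (modulo 3). Of its out-neighbours outside its part, those in part
  \<open>i - 1\<close> can compete only for colour \<open>i\<close>, and those in part \<open>i + 1\<close> only for colour \<open>i + 1\<close>.
  A vertex may therefore be pessimistic and count all of the former against colour \<open>i\<close> and all of
  the latter against colour \<open>i + 1\<close>, while an out-neighbour in its own part counts against the colour
  that it actually has. No out-neighbour is counted twice, so at least one of the two colours has at
  most half of the out-neighbours against it. Under this pessimistic count the choices in different
  parts no longer interact, and the final colouring can only be better than the count predicts.

  Within one part every vertex prefers to differ from its out-neighbours, all of which lie on the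
  other side of the bipartition. Exchanging the roles of the two colours on one side turns this into
  a preference for agreement, which is monotone, and the Knaster--Tarski fixed point theorem
  provides a consistent choice. This is \<open>bipartite_biased_majority\<close>; the fixed point is taken for the
  three parts at once.
\<close>

text \<open>
  The two colours are membership and non-membership in \<open>U\<close>; the numbers \<open>a v\<close> and \<open>b v\<close> are votes
  against them that are cast in advance. The proof takes the least fixed point of a map on the set
  \<open>S\<close> of vertices \<open>v\<close> for which \<open>v \<in> U \<longleftrightarrow> side v\<close>. Every \<open>w \<in> N v\<close> is on the other side, so it
  has the same colour as \<open>v\<close> exactly if one of \<open>v\<close>, \<open>w\<close> is in \<open>S\<close> and the other is not: enlarging
  \<open>S\<close> makes it easier to belong to \<open>S\<close>.
\<close>

lemma bipartite_biased_majority: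
  fixes N :: "'a \<Rightarrow> 'a set" and a b d :: "'a \<Rightarrow> nat" and side :: "'a \<Rightarrow> bool"
  assumes fin: "\<And>v. finite (N v)"
    and bip: "\<And>v w. w \<in> N v \<Longrightarrow> side w \<noteq> side v"
    and total: "\<And>v. a v + b v + card (N v) \<le> d v"
  shows "\<exists>U. \<forall>v. (v \<in> U \<longrightarrow> 2 * (a v + card (N v \<inter> U)) \<le> d v) \<and>
                  (v \<notin> U \<longrightarrow> 2 * (b v + card (N v - U)) \<le> d v)"
proof -
  define F where "F S = {v. 2 * ((if side v then a v else b v) + card (N v - S)) \<le> d v}" for S
  have "mono F"
  proof (rule monoI)
    fix S T :: "'a set"
    assume "S \<subseteq> T"
    then have "card (N v - T) \<le> card (N v - S)" for v
      using fin by (intro card_mono) auto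
    then show "F S \<subseteq> F T"
      unfolding F_def by (smt (verit) Collect_mono add_le_mono le_trans mult_le_mono2 order_refl)
  qed
  define S where "S = lfp F"
  have "F S = S"
    unfolding S_def using lfp_unfold[OF \<open>mono F\<close>] by simp
  then have S: "v \<in> S \<longleftrightarrow> 2 * ((if side v then a v else b v) + card (N v - S)) \<le> d v" for v
    unfolding F_def by blast
  define U where "U = {v. v \<in> S \<longleftrightarrow> side v}"
  have "(v \<in> U \<longrightarrow> 2 * (a v + card (N v \<inter> U)) \<le> d v) \<and>
        (v \<notin> U \<longrightarrow> 2 * (b v + card (N v - U)) \<le> d v)" for v
  proof -
    have split: "card (N v \<inter> S) + card (N v - S) = card (N v)"
      using card_Int_Diff[OF fin] by metis
    have U: "N v \<inter> U = (if side v then N v - S else N v \<inter> S)"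
            "N v - U = (if side v then N v \<inter> S else N v - S)"
      using bip unfolding U_def by auto
    show ?thesis
      unfolding U using S[of v] split total[of v] by (auto simp: U_def)
  qed
  then show ?thesis
    by blast
qed

theorem theorem1:
  fixes D :: "('a, 'b) pre_digraph"
  assumes "digraph D"
    and "chromatic_number (underlying_graph D) \<le> 6"
  shows "majority_colorable D 3"
proof -
  interpret digraph D by fact
  have "\<exists>c. proper_coloring (underlying_graph D) (chromatic_number (underlying_graph D)) c"
    unfolding chromatic_number_def by (rule LeastI_ex) (rule ex_proper_coloring)
  then obtain h where h: "proper_coloring (underlying_graph D) (chromatic_number (underlying_graph D)) h"
    by blast
  have h_range: "1 \<le> h v \<and> h v \<le> 6" if "v \<in> verts D" for v
    using h that assms(2) unfolding proper_coloring_def by fastforce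
  have h_adj: "h v \<noteq> h w" if "v \<rightarrow>\<^bsub>D\<^esub> w" for v w
    using h that unfolding proper_coloring_def underlying_graph_adj_iff by blast

  let ?N = "out_neighbors D"
  have fin: "finite (?N v)" for v
    unfolding out_neighbors_def
    by (rule finite_subset[OF _ finite_verts]) (auto dest: adj_in_verts)
  \<comment> \<open>The colour classes \<open>j\<close> and \<open>j + 3\<close> of \<open>h\<close> form one part; \<open>side\<close> tells them apart.\<close>
  define part where "part v = h v mod 3" for v
  define side where "side v \<longleftrightarrow> h v \<le> 3" for v
  define same where "same v = {w \<in> ?N v. part w = part v}" for v
  define prev where "prev v = {w \<in> ?N v. (part w + 1) mod 3 = part v}" for v
  define succ where "succ v = {w \<in> ?N v. part w = (part v + 1) mod 3}" for v
  have part_less: "part v < 3" for v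
    unfolding part_def by simp
  have fins: "finite (same v)" "finite (prev v)" "finite (succ v)" for v
    unfolding same_def prev_def succ_def using fin by auto
  have residues: "n = 0 \<or> n = 1 \<or> n = 2" if "n < 3" for n :: nat
    using that by linarith

  have bip: "side w \<noteq> side v" if "w \<in> same v" for v w
  proof
    assume "side w = side v"
    moreover have adj: "v \<rightarrow>\<^bsub>D\<^esub> w" and "h w mod 3 = h v mod 3"
      using that unfolding same_def out_neighbors_def part_def by auto
    moreover have "h v \<in> {1, 2, 3, 4, 5, 6}" "h w \<in> {1, 2, 3, 4, 5, 6}"
      using h_range[of v] h_range[of w] adj_in_verts[OF adj] by auto
    ultimately have "h v = h w"
      unfolding side_def by auto
    with h_adj[OF adj] show False ..
  qed
  have total: "card (prev v) + card (succ v) + card (same v) \<le> card (?N v)" for v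
  proof -
    have "prev v \<inter> succ v = {}" "(prev v \<union> succ v) \<inter> same v = {}"
      using residues[OF part_less[of v]] unfolding prev_def succ_def same_def by auto
    then have "card (prev v) + card (succ v) + card (same v) = card (prev v \<union> succ v \<union> same v)"
      using fins by (simp add: card_Un_disjoint)
    also have "\<dots> \<le> card (?N v)"
      using fin by (intro card_mono) (auto simp: prev_def succ_def same_def)
    finally show ?thesis .
  qed
  have "\<exists>U. \<forall>v. (v \<in> U \<longrightarrow> 2 * (card (prev v) + card (same v \<inter> U)) \<le> card (?N v)) \<and>
                 (v \<notin> U \<longrightarrow> 2 * (card (succ v) + card (same v - U)) \<le> card (?N v))"
    by (rule bipartite_biased_majority[where side = side, OF fins(1) bip total])
  then obtain U where
    U_in: "v \<in> U \<Longrightarrow> 2 * (card (prev v) + card (same v \<inter> U)) \<le> card (?N v)" and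
    U_out: "v \<notin> U \<Longrightarrow> 2 * (card (succ v) + card (same v - U)) \<le> card (?N v)" for v
    by metis

  \<comment> \<open>Residues modulo 3, shifted by one so that the colours are \<open>1, 2, 3\<close>.\<close>
  define c where "c v = (if v \<in> U then part v else (part v + 1) mod 3) + 1" for v
  have "2 * card {w \<in> ?N v. c w = c v} \<le> card (?N v)" for v
  proof (cases "v \<in> U")
    case True
    have "{w \<in> ?N v. c w = c v} \<subseteq> prev v \<union> (same v \<inter> U)"
      using True by (auto simp: c_def prev_def same_def split: if_splits)
    then have "card {w \<in> ?N v. c w = c v} \<le> card (prev v \<union> (same v \<inter> U))"
      using fins by (intro card_mono) auto
    also have "\<dots> \<le> card (prev v) + card (same v \<inter> U)"
      by (rule card_Un_le)
    finally show ?thesis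
      using U_in[OF True] by (meson mult_le_mono2 order_trans)
  next
    case False
    have shift_inj: "part w = part v" if "(part w + 1) mod 3 = (part v + 1) mod 3" for w
      using that residues[OF part_less[of v]] residues[OF part_less[of w]] by auto
    have "{w \<in> ?N v. c w = c v} \<subseteq> succ v \<union> (same v - U)"
      using False shift_inj by (auto simp: c_def succ_def same_def split: if_splits)
    then have "card {w \<in> ?N v. c w = c v} \<le> card (succ v \<union> (same v - U))"
      using fins by (intro card_mono) auto
    also have "\<dots> \<le> card (succ v) + card (same v - U)"
      by (rule card_Un_le)
    finally show ?thesis
      using U_out[OF False] by (meson mult_le_mono2 order_trans)
  qed
  moreover have "c ` verts D \<subseteq> {1..3}"
  proof -
    have "c v \<in> {1..3}" for v
      unfolding c_def using part_less[of v] by (auto simp: less_Suc_eq_le Suc_leI)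
    then show ?thesis by blast
  qed
  ultimately show ?thesis
    unfolding majority_colorable_def majority_coloring_def by blast
qed

end
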